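(* Let $X=\{X(k)\}_{k\in\mathbb{Z}}$ be a strictly stationary, almost surely positive, heavy-tailed process with tail exponent $\alpha>0$, i.e. $P\{X(k)>x\}\sim\sigma_0^\alpha x^{-\alpha}$ as $x\to\infty$ for some $\sigma_0>0$. With $X_m(k)=\max_{1\le i\le m}X(m(k-1)+i)$, suppose that $$\Big\{\frac1{m^{1/\alpha}}X_m(k)\Big\}_{k\in\mathbb{N}}\stackrel{d}{\longrightarrow}\{Z(k)\}_{k\in\mathbb{N}},\qquad m\to\infty,$$ in the sense of convergence of finite-dimensional distributions, where the $Z(k)$ are i.i.d. $\alpha$-Fréchet random variables. Fix the number of block-maxima $r\in\mathbb{N}$, let $\ell=[\log_2r]$, let $w_1,\dots,w_\ell$ be real weights with $\sum_{i=1}^\ell w_i=0$ and $\sum_{i=1}^\ell i\,w_i=1$, and let $j(n)=[\log_2(n/r)]$. From the sample $X(1),\dots,X(n)$ form the max-spectrum $Y_j$, and define $$\widehat\alpha_n=\Big(\sum_{i=1}^\ell w_iY_{i+j(n)}\Big)^{-1},\qquad \widehat\alpha_Z=\Big(\sum_{i=1}^\ell w_iY_i^Z\Big)^{-1},$$ where $\{Y_i^Z\}_{i=1}^\ell$ is the max-spectrum of the sample $Z(1),\dots,Z(r)$ of i.i.d. $\alpha$-Fréchet variables. Then $$\widehat\alpha_n\stackrel{d}{\longrightarrow}\widehat\alpha_Z,\qquad n\to\infty.$$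
   Context: $[x]$ is the integer part of $x$. The max-spectrum of a sample $X(1),\dots,X(n)$ is $$Y_j=\frac1{n_j}\sum_{k=1}^{n_j}\log_2D(j,k),\qquad D(j,k)=\max_{1\le i\le2^j}X(2^j(k-1)+i),\qquad n_j=[n/2^j],\qquad 1\le j\le[\log_2 n];$$ the max-spectrum of $Z(1),\dots,Z(r)$ is defined in the same way, with $Z$ in place of $X$ and $r$ in place of $n$. A random variable $Z$ is $\alpha$-Fréchet with scale $\sigma>0$ if $P\{Z\le x\}=\exp\{-\sigma^\alpha x^{-\alpha}\}$ for $x>0$ and $0$ for $x\le0$. The relation $a(x)\sim b(x)$ means $a(x)/b(x)\to1$.
   Formalization: n tends to infinity only along sample sizes with [n/2^{i+j(n)}]=[r/2^i] for i=1..ℓ (e.g. when [n/2^{j(n)}]=r); for all n the claim fails, e.g. X i.i.d. Fréchet, r=4, w=(-1,1), n=6·2^j, where 3 block maxima are averaged instead of 2. *)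

theory Defs
  imports "HOL-Probability.Probability" "HOL-Library.Landau_Symbols"
begin

definition strictly_stationary :: "'a measure \<Rightarrow> (int \<Rightarrow> 'a \<Rightarrow> real) \<Rightarrow> bool" where
  "strictly_stationary M X \<longleftrightarrow>
     (\<forall>J h. finite J \<longrightarrow>
        distr M (\<Pi>\<^sub>M k\<in>J. borel) (\<lambda>\<omega>. \<lambda>k\<in>J. X (k + h) \<omega>) =
        distr M (\<Pi>\<^sub>M k\<in>J. borel) (\<lambda>\<omega>. \<lambda>k\<in>J. X k \<omega>))"

definition frechet_rv :: "'a measure \<Rightarrow> real \<Rightarrow> real \<Rightarrow> ('a \<Rightarrow> real) \<Rightarrow> bool" where
  "frechet_rv M \<alpha> \<sigma> Z \<longleftrightarrow> Z \<in> borel_measurable M \<and>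
     (\<forall>x. measure M {\<omega> \<in> space M. Z \<omega> \<le> x} =
       (if x > 0 then exp (- (\<sigma> powr \<alpha> * x powr (- \<alpha>))) else 0))"

text \<open>Convergence of finite-dimensional distributions. For a finite set \<open>J\<close> of indices the vector
  indexed by \<open>J\<close> is an element of the product \<open>\<real>\<^sup>J\<close>, and weak convergence in \<open>\<real>\<^sup>J\<close> is tested by
  the bounded continuous functions on it.\<close>

definition fdd_convergence ::
    "'a measure \<Rightarrow> (nat \<Rightarrow> 'i \<Rightarrow> 'a \<Rightarrow> real) \<Rightarrow> 'b measure \<Rightarrow> ('i \<Rightarrow> 'b \<Rightarrow> real) \<Rightarrow> 'i set \<Rightarrow> bool" where
  "fdd_convergence M V P Z T \<longleftrightarrow>
     (\<forall>J f. finite J \<and> J \<subseteq> T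
        \<and> continuous_map (product_topology (\<lambda>_. euclideanreal) J) euclideanreal f
        \<and> bounded (f ` (\<Pi>\<^sub>E k\<in>J. UNIV)) \<longrightarrow>
        (\<lambda>m. \<integral>\<omega>. f (\<lambda>k\<in>J. V m k \<omega>) \<partial>M) \<longlonglongrightarrow> (\<integral>\<omega>. f (\<lambda>k\<in>J. Z k \<omega>) \<partial>P))"

text \<open>A sample is a function on the naturals of which only the values at \<open>1, 2, \<dots>\<close> are used;
  blocks are numbered from \<open>k = 1\<close>.\<close>

definition block_max :: "nat \<Rightarrow> (nat \<Rightarrow> real) \<Rightarrow> nat \<Rightarrow> real" where
  "block_max m S k = Max ((\<lambda>i. S (m * (k - 1) + i)) ` {1..m})"

text \<open>\<open>n div 2 ^ j\<close> is \<open>n\<^sub>j\<close>; the spectrum is meaningful for \<open>2 ^ j \<le> n\<close>.\<close>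

definition max_spectrum :: "(nat \<Rightarrow> real) \<Rightarrow> nat \<Rightarrow> nat \<Rightarrow> real" where
  "max_spectrum S n j =
     (1 / real (n div 2 ^ j)) * (\<Sum>k = 1..n div 2 ^ j. log 2 (block_max (2 ^ j) S k))"

definition int_log2 :: "real \<Rightarrow> nat" where
  "int_log2 x = nat \<lfloor>log 2 x\<rfloor>"

definition base_scale :: "nat \<Rightarrow> nat \<Rightarrow> nat" where
  "base_scale r n = int_log2 (real n / real r)"

definition alpha_hat :: "(nat \<Rightarrow> real) \<Rightarrow> nat \<Rightarrow> (nat \<Rightarrow> real) \<Rightarrow> nat \<Rightarrow> nat \<Rightarrow> real" where
  "alpha_hat w l S n j = inverse (\<Sum>i = 1..l. w i * max_spectrum S n (i + j))"

text \<open>The sample size \<open>n\<close> leaves the number of block-maxima fixed: at each scale \<open>i + j(n)\<close> used by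
  the estimator, the sample of size \<open>n\<close> has exactly as many complete blocks as a sample of size \<open>r\<close>
  has at scale \<open>i\<close>. This holds in particular when the number \<open>n div 2 ^ j(n)\<close> of blocks at the base
  scale equals \<open>r\<close>. It does not follow from the definition of \<open>j(n)\<close>, which only gives
  \<open>r \<le> n div 2 ^ j(n) < 2 * r\<close>; for the remaining \<open>n\<close> the averages in the spectrum run over more
  block-maxima than those in the spectrum of \<open>Z(1), \<dots>, Z(r)\<close>, and the limit law is in general different.\<close>

definition fixed_block_counts :: "nat \<Rightarrow> nat \<Rightarrow> bool" where
  "fixed_block_counts r n \<longleftrightarrow>
     (\<forall>i\<in>{1..int_log2 (real r)}. n div 2 ^ (i + base_scale r n) = r div 2 ^ i)"

end

theory Submission
  imports Defs
begin

text \<open>At scale \<open>i + j(n)\<close> the block maxima of \<open>X\<close> are the scale-\<open>i\<close> block maxima of the sequence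
  \<open>X\<^sub>m(k)\<close> with \<open>m = 2\<^bsup>j(n)\<^esup>\<close>, and since the weights sum to zero the contrast \<open>\<Sum>\<^sub>i w\<^sub>i Y\<^sub>i\<close> is blind to
  the normalisation by \<open>m\<^bsup>1/\<alpha>\<^esup>\<close>. Hence almost surely the estimator is a fixed function \<open>1 / h\<close> of the
  first \<open>r\<close> normalised block maxima, which converge in law. The function \<open>h\<close> is continuous on the
  positive orthant, so the continuous mapping theorem applies once \<open>h(Z(1), \<dots>, Z(r)) \<noteq> 0\<close> almost surely.
  For this let \<open>i\<^sub>0\<close> be the finest scale with nonzero weight. Of the first two blocks of length \<open>2\<^bsup>i\<^sub>0\<^esup>\<close> the
  one with the smaller maximum does not influence any coarser scale, so given all other variables
  \<open>h = 0\<close> determines that maximum, which has no atoms.\<close>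

section \<open>Block maxima and the max-spectrum\<close>

lemma block_max_cong:
  assumes "\<And>i. i \<in> {1..m} \<Longrightarrow> S (m * (k - 1) + i) = T (m * (k - 1) + i)"
  shows "block_max m S k = block_max m T k"
  unfolding block_max_def using assms by (intro arg_cong[where f = Max] image_cong) auto

lemma block_index_le:
  fixes m k i r :: nat
  assumes "k \<ge> 1" "k * m \<le> r" "i \<le> m"
  shows "m * (k - 1) + i \<le> r"
proof -
  have "m * (k - 1) + i \<le> m * (k - 1) + m" using assms by simp
  also have "\<dots> = k * m" using assms(1) by (cases k) auto
  finally show ?thesis using assms(2) by simp
qed

lemma block_max_pos:
  assumes "m \<ge> 1" "\<And>i. i \<in> {1..m} \<Longrightarrow> S (m * (k - 1) + i) > 0"
  shows "block_max m S k > 0"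
  unfolding block_max_def using assms by (subst Max_gr_iff) (auto intro!: bexI[of _ 1])

lemma block_max_scale:
  assumes "m \<ge> 1" "c > 0"
  shows "block_max m (\<lambda>i. c * S i) k = c * block_max m S k"
proof -
  have "mono (\<lambda>x::real. c * x)"
    using assms by (intro monoI mult_left_mono) auto
  then have "c * Max ((\<lambda>i. S (m * (k - 1) + i)) ` {1..m}) =
      Max ((\<lambda>x. c * x) ` (\<lambda>i. S (m * (k - 1) + i)) ` {1..m})"
    by (rule mono_Max_commute) (use assms in auto)
  then show ?thesis by (simp add: block_max_def image_image)
qed

text \<open>Block \<open>k\<close> of length \<open>m * a\<close> splits into \<open>a\<close>
  consecutive blocks of length \<open>m\<close>, so the maximum can be taken in two stages. This
  turns scale \<open>i + j\<close> of the sample into scale \<open>i\<close> of its block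
  maxima.\<close>

lemma block_max_block_max:
  assumes "a \<ge> 1" "m \<ge> 1" "k \<ge> 1"
  shows "block_max a (block_max m S) k = block_max (m * a) S k"
proof -
  have "Max ((\<lambda>i. S (m * a * (k - 1) + i)) ` {1..m * a}) =
      Max ((\<lambda>i. Max ((\<lambda>i'. S (m * (a * (k - 1) + i - 1) + i')) ` {1..m})) ` {1..a})"
  proof (rule Max_eqI)
    show "finite ((\<lambda>i. S (m * a * (k - 1) + i)) ` {1..m * a})" by simp
  next
    fix y assume "y \<in> (\<lambda>i. S (m * a * (k - 1) + i)) ` {1..m * a}"
    then obtain i where i: "i \<in> {1..m * a}" "y = S (m * a * (k - 1) + i)" by auto
    \<comment> \<open>Dividing the zero-based position \<open>i - 1\<close> by \<open>m\<close>
      gives the inner block and the place in it; the added ones restore numbering from 1.\<close>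
    define p q where "p = (i - 1) div m + 1" and "q = (i - 1) mod m + 1"
    have q: "q \<in> {1..m}" using assms by (auto simp: q_def Suc_le_eq)
    have "(i - 1) div m < a" using i assms by (intro less_mult_imp_div_less) (auto simp: mult.commute)
    then have p: "p \<in> {1..a}" by (auto simp: p_def)
    have "m * (p - 1) + q = (i - 1) div m * m + (i - 1) mod m + 1"
      by (simp add: p_def q_def)
    also have "\<dots> = i" using i by simp
    finally have "i = m * (p - 1) + q" ..
    moreover have "a * (k - 1) + p - 1 = a * (k - 1) + (p - 1)" using p by auto
    ultimately have "y = S (m * (a * (k - 1) + p - 1) + q)"
      using i by (simp add: algebra_simps)
    also have "\<dots> \<le> Max ((\<lambda>i'. S (m * (a * (k - 1) + p - 1) + i')) ` {1..m})"
      using q by (intro Max_ge) auto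
    also have "\<dots> \<le> Max ((\<lambda>i. Max ((\<lambda>i'. S (m * (a * (k - 1) + i - 1) + i')) ` {1..m})) ` {1..a})"
      using p by (intro Max_ge) auto
    finally show "y \<le> \<dots>" .
  next
    let ?B = "\<lambda>i. Max ((\<lambda>i'. S (m * (a * (k - 1) + i - 1) + i')) ` {1..m})"
    have "Max (?B ` {1..a}) \<in> ?B ` {1..a}" using assms by (intro Max_in) auto
    then obtain p where p: "p \<in> {1..a}" "Max (?B ` {1..a}) = ?B p" by auto
    have "?B p \<in> (\<lambda>i'. S (m * (a * (k - 1) + p - 1) + i')) ` {1..m}"
      using assms by (intro Max_in) auto
    then obtain q where q: "q \<in> {1..m}" "?B p = S (m * (a * (k - 1) + p - 1) + q)" by auto
    have "m * (a * (k - 1) + p - 1) + q = m * a * (k - 1) + (m * (p - 1) + q)"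
      using p by (cases p) (auto simp: algebra_simps)
    moreover have "m * (p - 1) + q \<in> {1..m * a}"
      using p q block_index_le[of p m "m * a" q] by (auto simp: mult.commute)
    ultimately show "Max (?B ` {1..a}) \<in> (\<lambda>i. S (m * a * (k - 1) + i)) ` {1..m * a}"
      using p(2) q(2) by (metis imageI)
  qed
  then show ?thesis by (simp add: block_max_def)
qed

text \<open>The spectrum averages complete blocks only, and these lie within the first
  \<open>r\<close> entries. An infinite sequence may therefore be exchanged for its restriction to
  \<open>{1..r}\<close>.\<close>

lemma max_spectrum_cong:
  assumes "\<And>q. q \<in> {1..r} \<Longrightarrow> S q = T q"
  shows "max_spectrum S r i = max_spectrum T r i"
proof -
  have "block_max (2 ^ i) S k = block_max (2 ^ i) T k" if "k \<in> {1..r div 2 ^ i}" for k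
  proof (rule block_max_cong, rule assms)
    fix q assume "q \<in> {1..(2::nat) ^ i}"
    moreover have "k * 2 ^ i \<le> r"
      using that by (simp add: less_eq_div_iff_mult_less_eq)
    ultimately show "2 ^ i * (k - 1) + q \<in> {1..r}"
      using that block_index_le[of k "2 ^ i" r q] by auto
  qed
  then show ?thesis by (simp add: max_spectrum_def)
qed

lemma alpha_hat_cong:
  assumes "\<And>q. q \<in> {1..r} \<Longrightarrow> S q = T q"
  shows "alpha_hat w l S r 0 = alpha_hat w l T r 0"
proof -
  have "max_spectrum S r i = max_spectrum T r i" for i
    using assms by (rule max_spectrum_cong)
  then show ?thesis by (simp add: alpha_hat_def)
qed

text \<open>The logarithm turns the factor \<open>c\<close> into a summand, which averaging
  preserves, so the shift \<open>log 2 c\<close> is the same at every scale. At least one block is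
  required because an empty average is 0 and would lose the shift.\<close>

lemma max_spectrum_block_max:
  assumes "c > 0" "\<And>i. S i > 0"
    and "n div 2 ^ (i + j) = r div 2 ^ i" "r div 2 ^ i \<ge> 1"
  shows "max_spectrum (\<lambda>q. c * block_max (2 ^ j) S q) r i = log 2 c + max_spectrum S n (i + j)"
proof -
  have "block_max (2 ^ i) (\<lambda>q. c * block_max (2 ^ j) S q) k = c * block_max (2 ^ (i + j)) S k"
    if "k \<ge> 1" for k
    using that assms(1) by (simp add: block_max_scale block_max_block_max power_add mult.commute)
  moreover have "block_max (2 ^ (i + j)) S k > 0" for k
    using assms(2) by (intro block_max_pos) auto
  ultimately have "(\<Sum>k = 1..r div 2 ^ i. log 2 (block_max (2 ^ i) (\<lambda>q. c * block_max (2 ^ j) S q) k))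
      = (\<Sum>k = 1..r div 2 ^ i. log 2 c + log 2 (block_max (2 ^ (i + j)) S k))"
    using assms(1) by (intro sum.cong) (auto simp: log_mult order_less_imp_not_eq2)
  then show ?thesis
    using assms(3,4) by (simp add: max_spectrum_def sum.distrib distrib_left)
qed

text \<open>Ensures at least one complete block at every scale entering the estimator.\<close>

lemma two_power_le_int_log2:
  assumes "r \<ge> 1" "i \<le> int_log2 (real r)"
  shows "(2::nat) ^ i \<le> r"
proof -
  have "real i \<le> log 2 (real r)"
    using assms by (simp add: int_log2_def le_nat_iff le_floor_iff)
  then have "2 powr real i \<le> real r"
    using assms(1) by (simp add: le_log_iff)
  then have "real (2 ^ i) \<le> real r" by (simp add: powr_realpow)
  then show ?thesis by (simp only: of_nat_le_iff)
qed

text \<open>Equal block counts make the spectra differ by \<open>log 2 c\<close> at each scale, and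
  weights with sum zero cancel this common shift. Any \<open>c > 0\<close> is allowed, so the
  normalisation may involve the unknown \<alpha>.\<close>

lemma alpha_hat_block_max:
  assumes "c > 0" "\<And>i. S i > 0" "r \<ge> 1" "fixed_block_counts r n"
    and "(\<Sum>i = 1..int_log2 (real r). w i) = 0"
  shows "alpha_hat w (int_log2 (real r)) S n (base_scale r n) =
    alpha_hat w (int_log2 (real r)) (\<lambda>q. c * block_max (2 ^ base_scale r n) S q) r 0"
proof -
  let ?l = "int_log2 (real r)" and ?T = "\<lambda>q. c * block_max (2 ^ base_scale r n) S q"
  have "max_spectrum ?T r i = log 2 c + max_spectrum S n (i + base_scale r n)" if "i \<in> {1..?l}" for i
  proof (rule max_spectrum_block_max)
    show "n div 2 ^ (i + base_scale r n) = r div 2 ^ i"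
      using assms(4) that by (auto simp: fixed_block_counts_def)
    show "r div 2 ^ i \<ge> 1"
      using two_power_le_int_log2[of r i] assms(3) that by (simp add: less_eq_div_iff_mult_less_eq)
  qed (use assms in auto)
  then have "(\<Sum>i = 1..?l. w i * max_spectrum ?T r i) =
      (\<Sum>i = 1..?l. w i) * log 2 c + (\<Sum>i = 1..?l. w i * max_spectrum S n (i + base_scale r n))"
    by (simp add: distrib_left sum.distrib sum_distrib_right)
  then show ?thesis using assms(5) by (simp add: alpha_hat_def)
qed

section \<open>The limiting contrast has no atom at zero\<close>

lemma borel_measurable_block_max [measurable]:
  "(\<lambda>v. block_max m v k) \<in> borel_measurable borel"
  unfolding block_max_def by measurable

lemma borel_measurable_max_spectrum [measurable]:
  "(\<lambda>v. max_spectrum v n j) \<in> borel_measurable borel"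
  unfolding max_spectrum_def by measurable

lemma borel_measurable_alpha_hat [measurable]:
  "(\<lambda>v. alpha_hat w l v n j) \<in> borel_measurable borel"
  unfolding alpha_hat_def by measurable

text \<open>By independence the law of the vector is a product measure, so Fubini applies: with all
  coordinates but \<open>q\<close> fixed, the section of \<open>S\<close> has at most one point,
  which is null because \<open>Z q\<close> has no atoms.\<close>

lemma (in prob_space) AE_indep_vars_null_sections:
  fixes Z :: "'i \<Rightarrow> 'a \<Rightarrow> real"
  assumes indep: "indep_vars (\<lambda>_. borel) Z I" and I: "finite I" "q \<in> I"
    and atomless: "\<And>x. prob {\<omega> \<in> space M. Z q \<omega> = x} = 0"
    and S: "S \<in> sets (Pi\<^sub>M I (\<lambda>_. borel))"
    and sections: "\<And>v y. v \<in> S \<Longrightarrow> v(q := y) \<in> S \<Longrightarrow> y = v q"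
  shows "AE \<omega> in M. (\<lambda>k\<in>I. Z k \<omega>) \<notin> S"
proof -
  have Z [measurable]: "Z k \<in> borel_measurable M" if "k \<in> I" for k
    using indep that by (auto simp: indep_vars_def)
  \<comment> \<open>A product of sigma-finite measures is declared over all indices, so those
    outside \<open>I\<close> receive a point mass at 0 as filler.\<close>
  define \<mu> where "\<mu> k = (if k \<in> I then distr M borel (Z k) else return borel 0)" for k
  have prob_\<mu>: "prob_space (\<mu> k)" for k
    by (auto simp: \<mu>_def intro: prob_space_distr prob_space_return)
  have sets_\<mu> [measurable_cong]: "sets (\<mu> k) = sets borel" for k by (simp add: \<mu>_def)
  interpret product_sigma_finite \<mu>
    using prob_\<mu> by (intro product_sigma_finite.intro prob_space_imp_sigma_finite)
  have "distr M (Pi\<^sub>M I (\<lambda>_. borel)) (\<lambda>\<omega>. \<lambda>k\<in>I. Z k \<omega>) = Pi\<^sub>M I (\<lambda>k. distr M borel (Z k))"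
    using indep I Z by (subst (asm) indep_vars_iff_distr_eq_PiM') auto
  also have "\<dots> = Pi\<^sub>M I \<mu>" by (intro PiM_cong) (auto simp: \<mu>_def)
  finally have distr: "distr M (Pi\<^sub>M I (\<lambda>_. borel)) (\<lambda>\<omega>. \<lambda>k\<in>I. Z k \<omega>) = Pi\<^sub>M I \<mu>" .
  have S': "S \<in> sets (Pi\<^sub>M I \<mu>)"
    using S sets_PiM_cong[of I I \<mu> "\<lambda>_. borel"] sets_\<mu> by auto
  have point: "emeasure (\<mu> q) {x} = 0" for x
  proof -
    have "Z q -` {x} \<inter> space M = {\<omega> \<in> space M. Z q \<omega> = x}" by auto
    then show ?thesis
      using I atomless[of x] by (simp add: \<mu>_def emeasure_distr emeasure_eq_measure)
  qed
  have insert: "insert q (I - {q}) = I" using I by auto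
  have "emeasure (Pi\<^sub>M I \<mu>) S = (\<integral>\<^sup>+ v. indicator S v \<partial>Pi\<^sub>M I \<mu>)"
    using S' by simp
  also have "\<dots> = (\<integral>\<^sup>+ v. indicator S v \<partial>Pi\<^sub>M (insert q (I - {q})) \<mu>)"
    by (simp only: insert)
  also have "\<dots> = (\<integral>\<^sup>+ v. (\<integral>\<^sup>+ y. indicator S (v(q := y)) \<partial>\<mu> q) \<partial>Pi\<^sub>M (I - {q}) \<mu>)"
  proof (rule product_nn_integral_insert)
    show "(indicator S :: _ \<Rightarrow> ennreal) \<in> borel_measurable (Pi\<^sub>M (insert q (I - {q})) \<mu>)"
      unfolding insert using S' by simp
  qed (use I in auto)
  also have "\<dots> = (\<integral>\<^sup>+ v. 0 \<partial>Pi\<^sub>M (I - {q}) \<mu>)"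
  proof (rule nn_integral_cong)
    fix v
    show "(\<integral>\<^sup>+ y. indicator S (v(q := y)) \<partial>\<mu> q) = 0"
    proof (cases "\<exists>y. v(q := y) \<in> S")
      case True
      \<comment> \<open>A nonempty section is the single point \<open>y\<close>: the hypothesis on
        sections, applied at \<open>v(q := y)\<close>, identifies every other candidate with
        \<open>y\<close>.\<close>
      then obtain y where y: "v(q := y) \<in> S" by blast
      have "y' = y" if "v(q := y') \<in> S" for y'
        using sections[OF y, of y'] that by simp
      then have "(\<integral>\<^sup>+ y'. indicator S (v(q := y')) \<partial>\<mu> q) \<le> (\<integral>\<^sup>+ y'. indicator {y} y' \<partial>\<mu> q)"
        by (intro nn_integral_mono) (auto simp: indicator_def)
      also have "\<dots> = 0" using point by (simp add: sets_\<mu>)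
      finally show ?thesis by simp
    qed simp
  qed
  finally have "emeasure (distr M (Pi\<^sub>M I (\<lambda>_. borel)) (\<lambda>\<omega>. \<lambda>k\<in>I. Z k \<omega>)) S = 0"
    by (simp add: distr)
  then have "AE v in distr M (Pi\<^sub>M I (\<lambda>_. borel)) (\<lambda>\<omega>. \<lambda>k\<in>I. Z k \<omega>). v \<notin> S"
    using S by (intro AE_not_in) (auto simp: null_sets_def)
  then show ?thesis
    by (subst (asm) AE_distr_iff) (use S in \<open>auto intro!: measurable_restrict Z\<close>)
qed

text \<open>Here \<open>3 - k\<close> is the sibling of \<open>k\<close> in \<open>{1, 2}\<close>.
  Since \<open>a \<ge> 2\<close>, both lie in the first block, and an entry not exceeding its
  sibling cannot raise the maximum.\<close>

lemma block_max_1_drop: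
  assumes "a \<ge> 2" "k \<in> {1, 2}" "u k \<le> u (3 - k)"
  shows "block_max a u 1 = Max (u ` ({1..a} - {k}))"
proof -
  have k: "k \<in> {1..a}" "3 - k \<in> {1..a} - {k}" using assms by auto
  then have "u ` {1..a} = insert (u k) (u ` ({1..a} - {k}))" by blast
  moreover have "u k \<le> Max (u ` ({1..a} - {k}))"
    using assms(3) k by (intro order.trans[OF _ Max_ge[of _ "u (3 - k)"]]) auto
  moreover have "u ` ({1..a} - {k}) \<noteq> {}" using k by blast
  ultimately have "Max (u ` {1..a}) = Max (u ` ({1..a} - {k}))"
    by (simp add: max_absorb2)
  then show ?thesis by (simp add: block_max_def)
qed

text \<open>A block that is dominated by its sibling is invisible at all coarser scales, so its maximum
  enters the contrast only through the finest scale with nonzero weight.\<close>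

lemma contrast_determines_dominated_block:
  fixes i\<^sub>0 :: nat and v v' :: "nat \<Rightarrow> real"
  defines "u \<equiv> \<lambda>S. block_max (2 ^ i\<^sub>0) S"
  assumes i0: "1 \<le> i\<^sub>0" "i\<^sub>0 < l" "w i\<^sub>0 \<noteq> 0" "\<forall>i\<in>{1..<i\<^sub>0}. w i = 0"
    and r: "2 ^ (i\<^sub>0 + 1) \<le> r" and k: "k \<in> {1, 2}"
    and other: "\<And>p. p \<ge> 1 \<Longrightarrow> p \<noteq> k \<Longrightarrow> u v p = u v' p"
    and dominated: "u v k \<le> u v (3 - k)" "u v' k \<le> u v' (3 - k)"
    and pos: "u v k > 0" "u v' k > 0"
    and eq: "(\<Sum>i = 1..l. w i * max_spectrum v r i) = (\<Sum>i = 1..l. w i * max_spectrum v' r i)"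
  shows "u v k = u v' k"
proof -
  have coarse: "max_spectrum v r i = max_spectrum v' r i" if "i > i\<^sub>0" for i
  proof -
    \<comment> \<open>The number of blocks of scale \<open>i\<^sub>0\<close> in one block of scale
      \<open>i\<close>.\<close>
    define a :: nat where "a = 2 ^ (i - i\<^sub>0)"
    have a: "a \<ge> 2" using that by (cases "i - i\<^sub>0") (auto simp: a_def)
    have prod: "2 ^ i = 2 ^ i\<^sub>0 * a" using that by (simp add: a_def flip: power_add)
    have "block_max (2 ^ i) v \<kappa> = block_max (2 ^ i) v' \<kappa>" if "\<kappa> \<ge> 1" for \<kappa>
    proof -
      have "block_max a (u v) \<kappa> = block_max a (u v') \<kappa>"
      proof (cases "\<kappa> = 1")
        case True
        have "u v ` ({1..a} - {k}) = u v' ` ({1..a} - {k})"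
          using other by (intro image_cong) auto
        then show ?thesis
          using True dominated block_max_1_drop[OF a k] by metis
      next
        case False
        show ?thesis
        proof (rule block_max_cong)
          fix s assume s: "s \<in> {1..a}"
          \<comment> \<open>From the second coarse block on, the fine blocks have numbers of at
            least 3, so the dominated block \<open>k\<close> is not among them.\<close>
          have "a * 1 \<le> a * (\<kappa> - 1)" using False that by (intro mult_left_mono) auto
          moreover have "s \<ge> 1" using s by simp
          ultimately have "a * (\<kappa> - 1) + s \<ge> 3" using a by linarith
          then show "u v (a * (\<kappa> - 1) + s) = u v' (a * (\<kappa> - 1) + s)"
            using k by (intro other) auto
        qed
      qed
      then show ?thesis
        using that a by (simp add: u_def block_max_block_max prod)
    qed
    then show ?thesis by (simp add: max_spectrum_def)
  qed
  \<comment> \<open>The coefficient of \<open>log 2 (u S k)\<close> in the contrast. It is nonzero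
    because the scale \<open>i\<^sub>0\<close> has at least two blocks and a nonzero weight.\<close>
  define c where "c = w i\<^sub>0 * (1 / real (r div 2 ^ i\<^sub>0))"
  have two: "r div 2 ^ i\<^sub>0 \<ge> 2" using r by (simp add: less_eq_div_iff_mult_less_eq)
  then have c: "c \<noteq> 0" using i0 by (simp add: c_def)
  have kin: "k \<in> {1..r div 2 ^ i\<^sub>0}" using k two by auto
  let ?rest = "\<lambda>S. \<Sum>p \<in> {1..r div 2 ^ i\<^sub>0} - {k}. log 2 (u S p)"
  have fine: "w i\<^sub>0 * max_spectrum S r i\<^sub>0 = c * (log 2 (u S k) + ?rest S)" for S
    using sum.remove[OF _ kin, of "\<lambda>p. log 2 (u S p)"] by (simp add: max_spectrum_def c_def u_def)
  have rest: "?rest v = ?rest v'" using other by (intro sum.cong) auto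
  have i0_in: "i\<^sub>0 \<in> {1..l}" using i0 by simp
  have "(\<Sum>i \<in> {1..l} - {i\<^sub>0}. w i * max_spectrum v r i) =
      (\<Sum>i \<in> {1..l} - {i\<^sub>0}. w i * max_spectrum v' r i)"
  proof (rule sum.cong)
    fix i assume "i \<in> {1..l} - {i\<^sub>0}"
    \<comment> \<open>Finer scales carry zero weight and coarser ones do not see block
      \<open>k\<close>, so the two contrasts can differ at scale \<open>i\<^sub>0\<close>
      only.\<close>
    then consider "1 \<le> i" "i < i\<^sub>0" | "i > i\<^sub>0" by fastforce
    then show "w i * max_spectrum v r i = w i * max_spectrum v' r i"
      using i0(4) coarse by cases auto
  qed simp
  then have "w i\<^sub>0 * max_spectrum v r i\<^sub>0 = w i\<^sub>0 * max_spectrum v' r i\<^sub>0"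
    using eq sum.remove[OF _ i0_in, of "\<lambda>i. w i * max_spectrum v r i"]
      sum.remove[OF _ i0_in, of "\<lambda>i. w i * max_spectrum v' r i"] by simp
  then have "log 2 (u v k) = log 2 (u v' k)" using c fine rest by simp
  moreover have "inj_on (log 2) {0<..}" by (rule log_inj) simp
  ultimately show ?thesis using pos by (simp add: inj_on_eq_iff)
qed

text \<open>The second identity forbids all weights being zero, the first forbids exactly one
  nonzero weight; hence the first nonzero weight is not the last one. The strict bound by
  \<open>l\<close> later provides two sibling blocks at scale \<open>i\<^sub>0\<close>.\<close>

lemma least_nonzero_weight:
  fixes w :: "nat \<Rightarrow> real"
  assumes "(\<Sum>i = 1..l. w i) = 0" "(\<Sum>i = 1..l. real i * w i) = 1"
  obtains i\<^sub>0 where "1 \<le> i\<^sub>0" "i\<^sub>0 < l" "w i\<^sub>0 \<noteq> 0" "\<forall>i\<in>{1..<i\<^sub>0}. w i = 0"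
proof -
  let ?Q = "\<lambda>i. 1 \<le> i \<and> i \<le> l \<and> w i \<noteq> 0"
  have "\<exists>i. ?Q i"
  proof (rule ccontr)
    assume "\<not> (\<exists>i. ?Q i)"
    then have "(\<Sum>i = 1..l. real i * w i) = (\<Sum>i = 1..l. 0)" by (intro sum.cong) auto
    with assms(2) show False by simp
  qed
  define i\<^sub>0 where "i\<^sub>0 = (LEAST i. ?Q i)"
  have Q: "?Q i\<^sub>0" unfolding i\<^sub>0_def using \<open>\<exists>i. ?Q i\<close> by (rule LeastI_ex)
  have below: "w i = 0" if "1 \<le> i" "i < i\<^sub>0" for i
    using not_less_Least[of i ?Q] that Q by (auto simp: i\<^sub>0_def)
  have "i\<^sub>0 \<noteq> l"
  proof
    assume "i\<^sub>0 = l"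
    then have "(\<Sum>i = 1..l. w i) = (\<Sum>i \<in> {l}. w i)"
      using Q below by (intro sum.mono_neutral_right) auto
    with assms(1) Q \<open>i\<^sub>0 = l\<close> show False by simp
  qed
  with Q have "i\<^sub>0 < l" by simp
  then show thesis using Q below by (intro that[of i\<^sub>0]) auto
qed

text \<open>Up to a null set, the event that the contrast vanishes is covered by finitely many sets,
  indexed by the dominated sibling block and by a place where its maximum is attained. Each of them
  is null because one coordinate is determined by the others.\<close>

lemma (in prob_space) AE_contrast_nonzero:
  fixes Z :: "nat \<Rightarrow> 'a \<Rightarrow> real"
  assumes indep: "indep_vars (\<lambda>_. borel) Z {1..r}"
    and pos: "\<And>k. k \<in> {1..r} \<Longrightarrow> AE \<omega> in M. Z k \<omega> > 0"
    and atomless: "\<And>k x. k \<in> {1..r} \<Longrightarrow> prob {\<omega> \<in> space M. Z k \<omega> = x} = 0"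
    and r: "2 ^ l \<le> r"
    and w: "(\<Sum>i = 1..l. w i) = 0" "(\<Sum>i = 1..l. real i * w i) = 1"
  shows "AE \<omega> in M. (\<Sum>i = 1..l. w i * max_spectrum (\<lambda>k\<in>{1..r}. Z k \<omega>) r i) \<noteq> 0"
proof -
  let ?I = "{1..r}" and ?h = "\<lambda>v. \<Sum>i = 1..l. w i * max_spectrum v r i"
  obtain i\<^sub>0 where i0: "1 \<le> i\<^sub>0" "i\<^sub>0 < l" "w i\<^sub>0 \<noteq> 0" "\<forall>i\<in>{1..<i\<^sub>0}. w i = 0"
    using w by (rule least_nonzero_weight)
  define m :: nat where "m = 2 ^ i\<^sub>0"
  have m: "m \<ge> 1" by (simp add: m_def)
  have "2 ^ (i\<^sub>0 + 1) \<le> (2::nat) ^ l" using i0 by (intro power_increasing) auto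
  then have r': "2 ^ (i\<^sub>0 + 1) \<le> r" using r by simp
  have index: "m * (k - 1) + s \<in> ?I" if "k \<in> {1, 2}" "s \<in> {1..m}" for k s
    using that r' block_index_le[of k m r s] by (auto simp: m_def)
  \<comment> \<open>In \<open>S k s\<close>, block \<open>k\<close> is the dominated sibling and
    \<open>s\<close> the place of its maximum. Positivity is included so that the logarithm
    determines the maximum.\<close>
  define S where "S k s = {v \<in> space (Pi\<^sub>M ?I (\<lambda>_. borel)). ?h v = 0 \<and>
      v (m * (k - 1) + s) = block_max m v k \<and> block_max m v k \<le> block_max m v (3 - k) \<and>
      block_max m v k > 0}" for k s
  \<comment> \<open>Points of the finite product equal \<open>undefined\<close> off the index set,
    so the remaining coordinates are constant and inclusion into all functions on \<open>nat\<close>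
    is measurable.\<close>
  have "(\<lambda>v. v k) \<in> borel_measurable (Pi\<^sub>M ?I (\<lambda>_. borel :: real measure))" for k
  proof (cases "k \<in> ?I")
    case False
    have "(\<lambda>v. undefined) \<in> borel_measurable (Pi\<^sub>M ?I (\<lambda>_. borel :: real measure))" by simp
    then show ?thesis
      by (rule measurable_cong[THEN iffD1, rotated])
        (use False in \<open>auto simp: space_PiM PiE_def extensional_def\<close>)
  qed (simp add: measurable_component_singleton)
  then have embed [measurable]: "(\<lambda>v. v) \<in> Pi\<^sub>M ?I (\<lambda>_. borel :: real measure) \<rightarrow>\<^sub>M borel"
    by (intro measurable_coordinatewise_then_product)
  have S_sets: "S k s \<in> sets (Pi\<^sub>M ?I (\<lambda>_. borel))" for k s
  proof -
    have "{v \<in> space borel. ?h v = 0 \<and> v (m * (k - 1) + s) = block_max m v k \<and>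
        block_max m v k \<le> block_max m v (3 - k) \<and> block_max m v k > 0} \<in> sets borel"
      by (intro sets.sets_Collect_conj borel_measurable_eq borel_measurable_le
          borel_measurable_less) measurable
    from measurable_sets[OF embed this] show ?thesis by (simp add: S_def vimage_def Int_def conj_commute)
  qed
  have "AE \<omega> in M. (\<lambda>k\<in>?I. Z k \<omega>) \<notin> S k s" if ks: "k \<in> {1, 2}" "s \<in> {1..m}" for k s
  proof (rule AE_indep_vars_null_sections[OF indep, where q = "m * (k - 1) + s"])
    let ?q = "m * (k - 1) + s"
    show "y = v ?q" if v: "v \<in> S k s" "v(?q := y) \<in> S k s" for v y
    proof -
      let ?v' = "v(?q := y)"
      \<comment> \<open>Changing coordinate \<open>?q\<close> affects block \<open>k\<close> alone.
        As this coordinate attains the block maximum in both vectors, equality of the maxima gives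
        \<open>y = v ?q\<close>.\<close>
      have "block_max (2 ^ i\<^sub>0) v k = block_max (2 ^ i\<^sub>0) ?v' k"
      proof (rule contrast_determines_dominated_block[where w = w and l = l, OF i0 r' ks(1)])
        fix p assume p: "p \<ge> 1" "p \<noteq> k"
        show "block_max (2 ^ i\<^sub>0) v p = block_max (2 ^ i\<^sub>0) ?v' p"
          unfolding m_def[symmetric]
        proof (rule block_max_cong)
          fix t assume t: "t \<in> {1..m}"
          have "m * (p - 1) + t \<noteq> ?q"
          proof
            assume "m * (p - 1) + t = ?q"
            \<comment> \<open>Positions are made zero-based so that division by \<open>m\<close>
              recovers the block number.\<close>
            then have "m * (p - 1) + (t - 1) = m * (k - 1) + (s - 1)"
              using t ks by (cases t; cases s) auto
            then have "(m * (p - 1) + (t - 1)) div m = (m * (k - 1) + (s - 1)) div m" by simp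
            moreover have "(t - 1) div m = 0" "(s - 1) div m = 0"
              using t ks(2) by auto
            ultimately have "p - 1 = k - 1" using m by simp
            then show False using p ks(1) by auto
          qed
          then show "v (m * (p - 1) + t) = ?v' (m * (p - 1) + t)" by simp
        qed
      qed (use v in \<open>auto simp: S_def m_def\<close>)
      then show ?thesis using v by (simp add: S_def m_def)
    qed
  qed (use index[OF ks] atomless S_sets in auto)
  then have "AE \<omega> in M. \<forall>k\<in>{1,2}. \<forall>s\<in>{1..m}. (\<lambda>k\<in>?I. Z k \<omega>) \<notin> S k s"
    by (intro AE_finite_allI) auto
  moreover have "AE \<omega> in M. \<forall>k\<in>?I. Z k \<omega> > 0" using pos by (intro AE_finite_allI) auto
  ultimately show ?thesis
  proof eventually_elim
    case (elim \<omega>)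
    let ?v = "\<lambda>k\<in>?I. Z k \<omega>"
    have "block_max m ?v 1 \<le> block_max m ?v 2 \<or> block_max m ?v 2 \<le> block_max m ?v 1" by linarith
    then obtain k where k: "k \<in> {1, 2}" "block_max m ?v k \<le> block_max m ?v (3 - k)"
      by (elim disjE) (force intro: that[of 1], force intro: that[of 2])
    have "block_max m ?v k \<in> (\<lambda>i. ?v (m * (k - 1) + i)) ` {1..m}"
      unfolding block_max_def using m by (intro Max_in) (auto simp del: restrict_apply)
    then obtain s where s: "s \<in> {1..m}" "?v (m * (k - 1) + s) = block_max m ?v k" by auto
    have "block_max m ?v k > 0"
      using index[OF k(1)] elim(2) m by (intro block_max_pos) auto
    moreover have "?v \<notin> S k s" using elim(1) k s by blast
    ultimately show "?h ?v \<noteq> 0"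
      using k s by (auto simp: S_def space_PiM)
  qed
qed

section \<open>A continuous mapping argument\<close>

lemma continuous_on_Max_image:
  fixes f :: "'i \<Rightarrow> 'a::topological_space \<Rightarrow> real"
  assumes "finite I" "I \<noteq> {}" "\<And>i. i \<in> I \<Longrightarrow> continuous_on A (f i)"
  shows "continuous_on A (\<lambda>x. Max ((\<lambda>i. f i x) ` I))"
  using assms
proof (induction I rule: finite_ne_induct)
  case (insert i I)
  then have "continuous_on A (\<lambda>x. max (f i x) (Max ((\<lambda>i. f i x) ` I)))"
    by (intro continuous_on_max) auto
  then show ?case using insert.hyps by simp
qed simp

text \<open>Truncation from below at \<open>e\<close> keeps every block maximum at least
  \<open>e\<close>, away from the discontinuity of the logarithm at 0.\<close>

lemma continuous_on_max_spectrum_truncated: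
  assumes "e > 0"
  shows "continuous_on UNIV (\<lambda>v. max_spectrum (\<lambda>q. max e (v q)) r i)"
proof -
  have "continuous_on UNIV (\<lambda>v. log 2 (block_max (2 ^ i) (\<lambda>q. max e (v q)) k))" for k
  proof (rule continuous_on_log)
    show "continuous_on UNIV (\<lambda>v. block_max (2 ^ i) (\<lambda>q. max e (v q)) k)"
      unfolding block_max_def
      by (intro continuous_on_Max_image continuous_on_max continuous_on_const
          continuous_on_product_coordinates) auto
    have "0 < block_max (2 ^ i) (\<lambda>q. max e (v q)) k" for v
      using assms by (intro block_max_pos) (auto simp: less_max_iff_disj)
    then show "\<forall>v\<in>UNIV. block_max (2 ^ i) (\<lambda>q. max e (v q)) k \<noteq> 0"
      by (auto simp: order_less_imp_not_eq2)
  qed auto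
  then show ?thesis
    unfolding max_spectrum_def
    by (intro continuous_on_mult continuous_on_const continuous_on_sum)
qed

text \<open>Test functions in \<open>fdd_convergence\<close> live on the product over
  \<open>I\<close>, whose points are \<open>undefined\<close> elsewhere. Inclusion into the full
  function space is continuous, since the extra coordinates are constant.\<close>

lemma continuous_map_product_of_continuous_on:
  fixes G :: "('i \<Rightarrow> real) \<Rightarrow> real"
  assumes "continuous_on UNIV G"
  shows "continuous_map (product_topology (\<lambda>_. euclideanreal) I) euclideanreal G"
proof -
  have "continuous_map (product_topology (\<lambda>_. euclideanreal) I)
      (product_topology (\<lambda>_. euclideanreal) UNIV) (\<lambda>v. v)"
    unfolding continuous_map_componentwise_UNIV
  proof
    fix k
    show "continuous_map (product_topology (\<lambda>_. euclideanreal) I) euclideanreal (\<lambda>v. v k)"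
    proof (cases "k \<in> I")
      case False
      have "continuous_map (product_topology (\<lambda>_. euclideanreal) I) euclideanreal (\<lambda>v. undefined)"
        by simp
      then show ?thesis
        by (rule continuous_map_eq) (use False in \<open>auto simp: PiE_def extensional_def\<close>)
    qed (rule continuous_map_product_projection)
  qed
  then have "continuous_map (product_topology (\<lambda>_. euclideanreal) I) euclidean (\<lambda>v. v)"
    by (simp only: euclidean_product_topology)
  moreover have "continuous_map euclidean euclideanreal G"
    using assms by simp
  ultimately show ?thesis
    using continuous_map_compose[of _ euclidean "\<lambda>v. v" euclideanreal G] by (simp add: o_def)
qed

lemma fdd_convergence_compose:
  assumes "fdd_convergence M V P Z T" "filterlim m at_top sequentially"
  shows "fdd_convergence M (\<lambda>t. V (m t)) P Z T"
  unfolding fdd_convergence_def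
proof (intro allI impI)
  fix J f
  assume "finite J \<and> J \<subseteq> T \<and> continuous_map (product_topology (\<lambda>_. euclideanreal) J) euclideanreal f \<and>
    bounded (f ` (\<Pi>\<^sub>E k\<in>J. UNIV))"
  then have "(\<lambda>m. \<integral>\<omega>. f (\<lambda>k\<in>J. V m k \<omega>) \<partial>M) \<longlonglongrightarrow> (\<integral>\<omega>. f (\<lambda>k\<in>J. Z k \<omega>) \<partial>P)"
    using assms(1) unfolding fdd_convergence_def by blast
  from filterlim_compose[OF this assms(2)]
  show "(\<lambda>t. \<integral>\<omega>. f (\<lambda>k\<in>J. V (m t) k \<omega>) \<partial>M) \<longlonglongrightarrow> (\<integral>\<omega>. f (\<lambda>k\<in>J. Z k \<omega>) \<partial>P)" .
qed

text \<open>The approximation error need not be uniformly small in \<open>t\<close>: its bound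
  \<open>1 - \<theta> n t\<close> tends to \<open>1 - \<theta>' n\<close>, which is small for a
  suitable \<open>n\<close>. That quantity is counted twice, next to the errors of \<open>a\<close>
  and \<open>\<theta>\<close>, hence quarters of \<open>e\<close>.\<close>

lemma LIMSEQ_approximation:
  fixes u :: "nat \<Rightarrow> real" and a \<theta> :: "nat \<Rightarrow> nat \<Rightarrow> real"
  assumes "\<And>n t. \<bar>u t - a n t\<bar> \<le> 1 - \<theta> n t" "\<And>n. \<bar>u' - a' n\<bar> \<le> 1 - \<theta>' n"
    and "\<And>n. a n \<longlonglongrightarrow> a' n" "\<And>n. \<theta> n \<longlonglongrightarrow> \<theta>' n" "\<theta>' \<longlonglongrightarrow> 1"
  shows "u \<longlonglongrightarrow> u'"
proof (rule tendstoI)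
  fix e :: real assume "e > 0"
  then have e: "e / 4 > 0" by simp
  obtain n where n: "\<bar>\<theta>' n - 1\<bar> < e / 4"
    using tendstoD[OF assms(5) e] by (auto simp: dist_real_def eventually_sequentially)
  have "\<forall>\<^sub>F t in sequentially. \<bar>a n t - a' n\<bar> < e / 4" "\<forall>\<^sub>F t in sequentially. \<bar>\<theta> n t - \<theta>' n\<bar> < e / 4"
    using tendstoD[OF assms(3) e] tendstoD[OF assms(4) e] by (auto simp: dist_real_def)
  then show "\<forall>\<^sub>F t in sequentially. dist (u t) u' < e"
  proof eventually_elim
    case (elim t)
    then show ?case
      using n assms(1)[of t n] assms(2)[of n] unfolding dist_real_def by linarith
  qed
qed

text \<open>Only \<open>x = 0\<close> needs care. There the factor \<open>\<bar>x\<bar> / e\<close>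
  tends to 0 while \<open>f\<close> stays bounded, and the damped function has value 0.\<close>

lemma continuous_on_bounded_inverse_damped:
  fixes f :: "real \<Rightarrow> real"
  assumes f: "\<And>x. isCont f x" "\<And>x. \<bar>f x\<bar> \<le> 1" and e: "e > 0"
  shows "continuous_on UNIV (\<lambda>x. f (inverse x) * min 1 (\<bar>x\<bar> / e))"
proof (rule continuous_at_imp_continuous_on, rule ballI)
  fix x :: real
  show "isCont (\<lambda>x. f (inverse x) * min 1 (\<bar>x\<bar> / e)) x"
  proof (cases "x = 0")
    case False
    then have "isCont (\<lambda>x. f (inverse x)) x"
      by (intro isCont_o2[OF _ f(1)] continuous_intros)
    then show ?thesis using e by (intro continuous_intros) auto
  next
    case True
    have "((\<lambda>y. \<bar>y\<bar> / e) \<longlongrightarrow> \<bar>0\<bar> / e) (at 0)" using e by (intro tendsto_intros) auto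
    then have "((\<lambda>y. \<bar>y\<bar> / e) \<longlongrightarrow> 0) (at 0)" by simp
    then have "((\<lambda>y. f (inverse y) * min 1 (\<bar>y\<bar> / e)) \<longlongrightarrow> 0) (at 0)"
    proof (rule Lim_null_comparison[rotated])
      have "\<bar>f (inverse y) * min 1 (\<bar>y\<bar> / e)\<bar> \<le> 1 * (\<bar>y\<bar> / e)" for y
        unfolding abs_mult using f(2) e by (intro mult_mono) auto
      then show "\<forall>\<^sub>F y in at 0. norm (f (inverse y) * min 1 (\<bar>y\<bar> / e)) \<le> \<bar>y\<bar> / e" by simp
    qed
    then show ?thesis using True by (simp add: isCont_def)
  qed
qed

lemma (in prob_space) integral_approx_le:
  fixes U A \<theta> :: "'a \<Rightarrow> real"
  assumes [measurable]: "U \<in> borel_measurable M" "A \<in> borel_measurable M" "\<theta> \<in> borel_measurable M"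
    and bdd: "\<And>x. \<bar>U x\<bar> \<le> 1" "\<And>x. \<bar>A x\<bar> \<le> 1" "\<And>x. \<bar>\<theta> x\<bar> \<le> 1"
    and le: "\<And>x. \<bar>U x - A x\<bar> \<le> 1 - \<theta> x"
  shows "\<bar>(\<integral>x. U x \<partial>M) - (\<integral>x. A x \<partial>M)\<bar> \<le> 1 - (\<integral>x. \<theta> x \<partial>M)"
proof -
  have [simp]: "integrable M U" "integrable M A" "integrable M \<theta>"
    using bdd by (auto intro!: integrable_const_bound[of _ 1])
  have "\<bar>(\<integral>x. U x \<partial>M) - (\<integral>x. A x \<partial>M)\<bar> = \<bar>\<integral>x. U x - A x \<partial>M\<bar>" by simp
  also have "\<dots> \<le> (\<integral>x. \<bar>U x - A x\<bar> \<partial>M)" by (rule integral_abs_bound)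
  also have "\<dots> \<le> (\<integral>x. 1 - \<theta> x \<partial>M)" using le by (intro integral_mono) auto
  also have "\<dots> = 1 - (\<integral>x. \<theta> x \<partial>M)" by (simp add: prob_space)
  finally show ?thesis .
qed

text \<open>The function \<open>inverse \<circ> h\<close> is continuous only on the part of the positive orthant where
  \<open>h \<noteq> 0\<close>. A test function composed with it is damped by a continuous weight that vanishes off this
  part, so that it becomes continuous on the whole space; the error is controlled by the mean of the
  weight, which is itself covered by the convergence assumption.\<close>

lemma weak_conv_m_inverse_of_fdd_convergence:
  fixes h :: "('i::countable \<Rightarrow> real) \<Rightarrow> real"
    and V :: "nat \<Rightarrow> 'i \<Rightarrow> 'a \<Rightarrow> real" and Z :: "'i \<Rightarrow> 'b \<Rightarrow> real"
  assumes M: "prob_space M" and P: "prob_space P"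
    and V: "\<And>t k. k \<in> I \<Longrightarrow> V t k \<in> borel_measurable M"
    and Z: "\<And>k. k \<in> I \<Longrightarrow> Z k \<in> borel_measurable P"
    and fdd: "fdd_convergence M V P Z T" and I: "finite I" "I \<subseteq> T"
    and cont: "\<And>e. e > 0 \<Longrightarrow> continuous_on UNIV (\<lambda>v. h (\<lambda>k. max e (v k)))"
    and local: "\<And>v v'. (\<And>k. k \<in> I \<Longrightarrow> v k = v' k) \<Longrightarrow> h v = h v'"
    and h [measurable]: "h \<in> borel_measurable borel"
    and pos: "AE \<omega> in P. \<forall>k\<in>I. Z k \<omega> > 0"
    and nonzero: "AE \<omega> in P. h (\<lambda>k\<in>I. Z k \<omega>) \<noteq> 0"
  shows "weak_conv_m (\<lambda>t. distr M borel (\<lambda>\<omega>. inverse (h (\<lambda>k\<in>I. V t k \<omega>))))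
    (distr P borel (\<lambda>\<omega>. inverse (h (\<lambda>k\<in>I. Z k \<omega>))))"
proof -
  interpret M: prob_space M by (rule M)
  interpret P: prob_space P by (rule P)
  have Vm [measurable]: "(\<lambda>\<omega>. \<lambda>k\<in>I. V t k \<omega>) \<in> borel_measurable M" for t
    by (rule measurable_coordinatewise_then_product, rename_tac k, case_tac "k \<in> I") (use V in auto)
  have Zm [measurable]: "(\<lambda>\<omega>. \<lambda>k\<in>I. Z k \<omega>) \<in> borel_measurable P"
    by (rule measurable_coordinatewise_then_product, rename_tac k, case_tac "k \<in> I") (use Z in auto)
  show ?thesis
  proof (rule integral_bdd_continuous_conv_imp_weak_conv)
    fix f :: "real \<Rightarrow> real" assume f: "\<And>x. isCont f x" "\<And>x. \<bar>f x\<bar> \<le> 1"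
    define e :: "nat \<Rightarrow> real" where "e n = inverse (real (Suc n))" for n
    have e: "e n > 0" for n by (simp add: e_def)
    \<comment> \<open>\<open>tr n\<close> is a globally continuous substitute for \<open>h\<close>.
      The ramp \<open>\<psi> n\<close> is 0 once some coordinate is at most \<open>e n\<close>, and
      1 when all are at least \<open>2 * e n\<close>; \<open>\<theta> n\<close> also damps near
      zeros of \<open>tr n\<close>.\<close>
    define tr where "tr n v = h (\<lambda>k. max (e n) (v k))" for n and v :: "'i \<Rightarrow> real"
    define \<psi> where "\<psi> n v = (\<Prod>k\<in>I. min 1 (max 0 (v k / e n - 1)))" for n and v :: "'i \<Rightarrow> real"
    define \<theta> where "\<theta> n v = min 1 (\<bar>tr n v\<bar> / e n) * \<psi> n v" for n v
    define A where "A n v = f (inverse (tr n v)) * \<theta> n v" for n v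
    have cont_f: "continuous_on UNIV f" using f(1) by (simp add: continuous_at_imp_continuous_on)
    have [measurable]: "f \<in> borel_measurable borel" using cont_f by (rule borel_measurable_continuous_onI)
    have cont_tr: "continuous_on UNIV (tr n)" for n
      unfolding tr_def using cont[OF e] .
    have cont_\<psi>: "continuous_on UNIV (\<psi> n)" for n
      unfolding \<psi>_def using e[of n]
      by (intro continuous_on_prod continuous_on_min continuous_on_max continuous_on_const
          continuous_on_diff continuous_on_divide continuous_on_product_coordinates) auto
    have cont_\<theta>: "continuous_on UNIV (\<theta> n)" for n
      unfolding \<theta>_def using e[of n] cont_tr cont_\<psi>
      by (intro continuous_on_mult continuous_on_min continuous_on_divide continuous_on_rabs) auto
    have cont_A: "continuous_on UNIV (A n)" for n
    proof -
      have "continuous_on UNIV (\<lambda>v. f (inverse (tr n v)) * min 1 (\<bar>tr n v\<bar> / e n))"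
        using continuous_on_compose2[OF continuous_on_bounded_inverse_damped[OF f e[of n]] cont_tr[of n]]
        by simp
      from continuous_on_mult[OF this cont_\<psi>[of n]] show ?thesis
        by (simp add: A_def \<theta>_def mult.assoc)
    qed
    have \<psi>_range: "0 \<le> \<psi> n v" "\<psi> n v \<le> 1" for n v
      unfolding \<psi>_def by (auto intro!: prod_nonneg prod_le_1)
    have \<theta>_range: "0 \<le> \<theta> n v" "\<theta> n v \<le> 1" for n v
      unfolding \<theta>_def using \<psi>_range[of n v] e[of n] by (auto intro!: mult_le_one)
    have A_bdd: "\<bar>A n v\<bar> \<le> 1" for n v
      unfolding A_def abs_mult using f(2) \<theta>_range by (intro mult_le_one) auto
    have \<theta>_bdd: "\<bar>\<theta> n v\<bar> \<le> 1" for n v using \<theta>_range[of n v] by simp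
    have approx: "\<bar>f (inverse (h v)) - A n v\<bar> \<le> 1 - \<theta> n v" for n v
    \<comment> \<open>If all coordinates exceed \<open>e n\<close>, truncation is inactive and
      damping costs at most \<open>1 - \<theta> n v\<close>. Otherwise the weight vanishes and the
      bound is just \<open>\<bar>f\<bar> \<le> 1\<close>.\<close>
    proof (cases "\<forall>k\<in>I. v k > e n")
      case True
      then have "tr n v = h v" unfolding tr_def by (intro local) (auto simp: max_def)
      then have "\<bar>f (inverse (h v)) - A n v\<bar> = \<bar>f (inverse (h v)) * (1 - \<theta> n v)\<bar>"
        by (simp add: A_def algebra_simps)
      also have "\<dots> \<le> 1 * (1 - \<theta> n v)"
        unfolding abs_mult using f(2) \<theta>_range[of n v] by (intro mult_mono) auto
      finally show ?thesis by simp
    next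
      case False
      then obtain k where "k \<in> I" "v k \<le> e n" by (auto simp: not_less)
      then have "\<psi> n v = 0"
        unfolding \<psi>_def using I e[of n] by (intro prod_zero) (auto intro!: bexI[of _ k] simp: field_simps)
      then show ?thesis using f(2) by (simp add: \<theta>_def A_def)
    qed
    have lim: "(\<lambda>t. \<integral>\<omega>. G (\<lambda>k\<in>I. V t k \<omega>) \<partial>M) \<longlonglongrightarrow> (\<integral>\<omega>. G (\<lambda>k\<in>I. Z k \<omega>) \<partial>P)"
      if "continuous_on UNIV G" "\<And>v. \<bar>G v\<bar> \<le> 1" for G :: "('i \<Rightarrow> real) \<Rightarrow> real"
    proof -
      have "bounded (G ` (\<Pi>\<^sub>E k\<in>I. UNIV))" using that(2) by (auto simp: bounded_iff)
      then show ?thesis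
        using fdd I continuous_map_product_of_continuous_on[OF that(1)]
        unfolding fdd_convergence_def by blast
    qed
    have [measurable]: "A n \<in> borel_measurable borel" "\<theta> n \<in> borel_measurable borel" for n
      using cont_A cont_\<theta> by (auto intro: borel_measurable_continuous_onI)
    \<comment> \<open>At a positive vector with \<open>h\<close> nonzero the weight is eventually 1,
      so dominated convergence applies. The limit law charges only such vectors.\<close>
    have "(\<lambda>n. \<integral>\<omega>. \<theta> n (\<lambda>k\<in>I. Z k \<omega>) \<partial>P) \<longlonglongrightarrow> (\<integral>\<omega>. 1 \<partial>P)"
    proof (rule integral_dominated_convergence[where w = "\<lambda>_. 1"])
      show "AE \<omega> in P. (\<lambda>n. \<theta> n (\<lambda>k\<in>I. Z k \<omega>)) \<longlonglongrightarrow> 1"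
        using pos nonzero
      proof eventually_elim
        case (elim \<omega>)
        let ?v = "\<lambda>k\<in>I. Z k \<omega>"
        have e_small: "\<forall>\<^sub>F n in sequentially. e n < c" if "c > 0" for c
          using order_tendstoD(2)[OF LIMSEQ_inverse_real_of_nat that] by (simp add: e_def)
        have "\<forall>\<^sub>F n in sequentially. e n < \<bar>h ?v\<bar>" using elim by (intro e_small) auto
        moreover have "\<forall>\<^sub>F n in sequentially. \<forall>k\<in>I. e n < Z k \<omega> / 2"
          using elim I by (intro eventually_ball_finite ballI e_small) auto
        ultimately have "\<forall>\<^sub>F n in sequentially. \<theta> n ?v = 1"
        proof eventually_elim
          case (elim n)
          have "e n \<le> Z k \<omega>" if "k \<in> I" for k using elim(2) that e[of n] by fastforce
          then have "tr n ?v = h ?v" unfolding tr_def by (intro local) (auto simp: max_def)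
          then have "min 1 (\<bar>tr n ?v\<bar> / e n) = 1" using elim(1) e[of n] by (simp add: field_simps)
          moreover have "\<psi> n ?v = 1"
            unfolding \<psi>_def
          proof (rule prod.neutral, rule ballI)
            fix k assume "k \<in> I"
            then have "e n * 2 < Z k \<omega>" using elim(2) by fastforce
            then show "min 1 (max 0 (?v k / e n - 1)) = 1"
              using \<open>k \<in> I\<close> e[of n] by (simp add: field_simps min_def max_def)
          qed
          ultimately show ?case by (simp add: \<theta>_def)
        qed
        then show ?case by (rule tendsto_eventually)
      qed
    qed (use \<theta>_bdd in auto)
    then have \<theta>_lim: "(\<lambda>n. \<integral>\<omega>. \<theta> n (\<lambda>k\<in>I. Z k \<omega>) \<partial>P) \<longlonglongrightarrow> 1" by (simp add: P.prob_space)
    have "(\<lambda>t. \<integral>\<omega>. f (inverse (h (\<lambda>k\<in>I. V t k \<omega>))) \<partial>M) \<longlonglongrightarrow>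
        (\<integral>\<omega>. f (inverse (h (\<lambda>k\<in>I. Z k \<omega>))) \<partial>P)"
    proof (rule LIMSEQ_approximation)
      show "\<bar>(\<integral>\<omega>. f (inverse (h (\<lambda>k\<in>I. V t k \<omega>))) \<partial>M) - (\<integral>\<omega>. A n (\<lambda>k\<in>I. V t k \<omega>) \<partial>M)\<bar>
          \<le> 1 - (\<integral>\<omega>. \<theta> n (\<lambda>k\<in>I. V t k \<omega>) \<partial>M)" for n t
        using f(2) A_bdd \<theta>_bdd approx by (intro M.integral_approx_le) auto
      show "\<bar>(\<integral>\<omega>. f (inverse (h (\<lambda>k\<in>I. Z k \<omega>))) \<partial>P) - (\<integral>\<omega>. A n (\<lambda>k\<in>I. Z k \<omega>) \<partial>P)\<bar>
          \<le> 1 - (\<integral>\<omega>. \<theta> n (\<lambda>k\<in>I. Z k \<omega>) \<partial>P)" for n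
        using f(2) A_bdd \<theta>_bdd approx by (intro P.integral_approx_le) auto
    qed (use lim[OF cont_A A_bdd] lim[OF cont_\<theta> \<theta>_bdd] \<theta>_lim in auto)
    then show "(\<lambda>t. integral\<^sup>L (distr M borel (\<lambda>\<omega>. inverse (h (\<lambda>k\<in>I. V t k \<omega>)))) f) \<longlonglongrightarrow>
        integral\<^sup>L (distr P borel (\<lambda>\<omega>. inverse (h (\<lambda>k\<in>I. Z k \<omega>)))) f"
      by (subst (1 2) integral_distr) auto
  qed auto
qed

section \<open>Asymptotic law of the estimator\<close>

text \<open>For \<open>x > 0\<close> the distribution function agrees near \<open>x\<close> with a
  continuous function, so it has no jump there; for \<open>x \<le> 0\<close> it vanishes.\<close>

lemma (in prob_space) frechet_rv_atomless:
  assumes "frechet_rv M \<alpha> \<sigma> Z"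
  shows "prob {\<omega> \<in> space M. Z \<omega> = x} = 0"
proof -
  have Z [measurable]: "Z \<in> borel_measurable M"
    and cdf: "prob {\<omega> \<in> space M. Z \<omega> \<le> y} =
      (if y > 0 then exp (- (\<sigma> powr \<alpha> * y powr (- \<alpha>))) else 0)" for y
    using assms by (auto simp: frechet_rv_def)
  show ?thesis
  proof (cases "x > 0")
    case False
    have "prob {\<omega> \<in> space M. Z \<omega> = x} \<le> prob {\<omega> \<in> space M. Z \<omega> \<le> x}"
      by (intro finite_measure_mono) auto
    with False show ?thesis by (simp add: cdf measure_le_0_iff)
  next
    case True
    let ?D = "distr M borel Z"
    interpret D: real_distribution ?D by (rule real_distribution_distr) (rule Z)
    have "cdf ?D y = prob {\<omega> \<in> space M. Z \<omega> \<le> y}" for y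
      by (auto simp: cdf_def measure_distr intro!: arg_cong[where f = prob])
    then have "\<forall>\<^sub>F y in nhds x. cdf ?D y = exp (- (\<sigma> powr \<alpha> * y powr (- \<alpha>)))"
      using eventually_nhds_in_open[of "{0<..}" x] True by (auto elim!: eventually_mono simp: cdf)
    then have "isCont (cdf ?D) x \<longleftrightarrow> isCont (\<lambda>y. exp (- (\<sigma> powr \<alpha> * y powr (- \<alpha>)))) x"
      by (rule isCont_cong)
    moreover have "isCont (\<lambda>y. exp (- (\<sigma> powr \<alpha> * y powr (- \<alpha>)))) x"
      using True by (intro continuous_intros) auto
    ultimately have "measure ?D {x} = 0" using D.isCont_cdf by simp
    moreover have "Z -` {x} \<inter> space M = {\<omega> \<in> space M. Z \<omega> = x}" by auto
    ultimately show ?thesis by (simp add: measure_distr)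
  qed
qed

lemma (in prob_space) frechet_rv_AE_pos:
  assumes "frechet_rv M \<alpha> \<sigma> Z"
  shows "AE \<omega> in M. Z \<omega> > 0"
proof -
  have Z [measurable]: "Z \<in> borel_measurable M"
    and "prob {\<omega> \<in> space M. Z \<omega> \<le> 0} = 0"
    using assms by (auto simp: frechet_rv_def)
  then have "AE \<omega> in M. \<not> Z \<omega> \<le> 0"
    by (subst (asm) prob_Collect_eq_0) auto
  then show ?thesis by eventually_elim simp
qed

text \<open>Lets the convergence assumed for block length \<open>m\<close> be used along the lengths
  \<open>2 ^ base_scale r n\<close>.\<close>

lemma filterlim_two_power_base_scale:
  assumes "r \<ge> 1"
  shows "filterlim (\<lambda>n. (2::nat) ^ base_scale r n) at_top at_top"
  unfolding filterlim_at_top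
proof
  fix c :: nat
  show "\<forall>\<^sub>F n in at_top. c \<le> 2 ^ base_scale r n"
    \<comment> \<open>From \<open>n \<ge> r * 2 ^ c\<close> the base scale is at least
      \<open>c\<close>, and \<open>c \<le> 2 ^ c\<close>.\<close>
    using eventually_ge_at_top[of "r * 2 ^ c"]
  proof eventually_elim
    case (elim n)
    have "real r * 2 ^ c \<le> real n" using elim by (metis of_nat_le_iff of_nat_mult of_nat_numeral of_nat_power)
    then have "2 powr real c \<le> real n / real r" using assms by (simp add: field_simps powr_realpow)
    moreover have "0 < 2 powr real c" by simp
    ultimately have "real c \<le> log 2 (real n / real r)"
      by (subst le_log_iff) linarith+
    then have "c \<le> base_scale r n" by (simp add: base_scale_def int_log2_def le_nat_iff le_floor_iff)
    also have "\<dots> \<le> 2 ^ base_scale r n" by (simp add: less_imp_le)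
    finally show ?case .
  qed
qed

text \<open>The sample size runs through a sequence \<open>N\<close> of sizes with fixed block
  counts; the sizes \<open>r * 2 ^ t\<close> are an example.\<close>

theorem theorem3p2:
  fixes M :: "'a measure" and P :: "'b measure"
    and X :: "int \<Rightarrow> 'a \<Rightarrow> real" and Z :: "nat \<Rightarrow> 'b \<Rightarrow> real"
    and \<alpha> \<sigma>\<^sub>0 \<sigma> :: real and r :: nat and w :: "nat \<Rightarrow> real" and N :: "nat \<Rightarrow> nat"
  defines "l \<equiv> int_log2 (real r)"
  assumes "prob_space M" and "prob_space P"
    and "\<And>k. X k \<in> borel_measurable M"
    and "strictly_stationary M X"
    and "\<And>k. AE \<omega> in M. X k \<omega> > 0"
    and "\<alpha> > 0" and "\<sigma>\<^sub>0 > 0"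
    and "\<And>k. (\<lambda>x. measure M {\<omega> \<in> space M. X k \<omega> > x}) \<sim>[at_top]
               (\<lambda>x. \<sigma>\<^sub>0 powr \<alpha> * x powr (- \<alpha>))"
    and "\<sigma> > 0"
    and "\<And>k. k \<ge> 1 \<Longrightarrow> frechet_rv P \<alpha> \<sigma> (Z k)"
    and "prob_space.indep_vars P (\<lambda>_. borel) Z {1..}"
    and "fdd_convergence M
           (\<lambda>m k \<omega>. (1 / real m powr (1 / \<alpha>)) * block_max m (\<lambda>i. X (int i) \<omega>) k) P Z {1..}"
    and "r \<ge> 1"
    and "(\<Sum>i = 1..l. w i) = 0"
    and "(\<Sum>i = 1..l. real i * w i) = 1"
    and "filterlim N at_top sequentially"
    and "\<And>t. fixed_block_counts r (N t)"
  shows "weak_conv_m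
           (\<lambda>t. distr M borel (\<lambda>\<omega>. alpha_hat w l (\<lambda>i. X (int i) \<omega>) (N t) (base_scale r (N t))))
           (distr P borel (\<lambda>\<omega>. alpha_hat w l (\<lambda>i. Z i \<omega>) r 0))"
proof -
  interpret M: prob_space M by fact
  interpret P: prob_space P by fact
  note X [measurable] = assms(4) and frechet = assms(11) and r = assms(14) and w = assms(15,16)
  let ?I = "{1..r}"
  define m :: "nat \<Rightarrow> nat" where "m t = 2 ^ base_scale r (N t)" for t
  define V where "V t k \<omega> = (1 / real (m t) powr (1 / \<alpha>)) * block_max (m t) (\<lambda>i. X (int i) \<omega>) k"
    for t k \<omega>
  define h where "h v = (\<Sum>i = 1..l. w i * max_spectrum v r i)" for v
  have alpha_hat_h: "alpha_hat w l v r 0 = inverse (h v)" for v by (simp add: alpha_hat_def h_def)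
  have Xm [measurable]: "(\<lambda>\<omega> i. X (int i) \<omega>) \<in> borel_measurable M"
    by (intro measurable_coordinatewise_then_product) simp
  have V [measurable]: "V t k \<in> borel_measurable M" for t k
    unfolding V_def by measurable
  have h [measurable]: "h \<in> borel_measurable borel" unfolding h_def by measurable
  have Z: "Z k \<in> borel_measurable P" if "k \<in> ?I" for k
    using frechet[of k] that by (auto simp: frechet_rv_def)
  have Z_pos: "AE \<omega> in P. Z k \<omega> > 0" if "k \<in> ?I" for k
    using P.frechet_rv_AE_pos[OF frechet] that by simp
  have h_local: "h v = h v'" if "\<And>k. k \<in> ?I \<Longrightarrow> v k = v' k" for v v'
    using max_spectrum_cong[of r v v'] that by (simp add: h_def)
  have "weak_conv_m (\<lambda>t. distr M borel (\<lambda>\<omega>. inverse (h (\<lambda>k\<in>?I. V t k \<omega>))))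
    (distr P borel (\<lambda>\<omega>. inverse (h (\<lambda>k\<in>?I. Z k \<omega>))))"
  proof (rule weak_conv_m_inverse_of_fdd_convergence[where T = "{1..}"])
    have "filterlim m at_top sequentially"
      unfolding m_def by (rule filterlim_compose[OF filterlim_two_power_base_scale[OF r] assms(17)])
    from fdd_convergence_compose[OF assms(13) this]
    show "fdd_convergence M V P Z {1..}" by (simp add: V_def[abs_def])
    show "continuous_on UNIV (\<lambda>v. h (\<lambda>k. max e (v k)))" if "e > 0" for e
      unfolding h_def using that
      by (intro continuous_on_sum continuous_on_mult continuous_on_const
          continuous_on_max_spectrum_truncated)
    show "AE \<omega> in P. \<forall>k\<in>?I. Z k \<omega> > 0" using Z_pos by (intro AE_finite_allI) auto
    show "AE \<omega> in P. h (\<lambda>k\<in>?I. Z k \<omega>) \<noteq> 0"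
      unfolding h_def
    proof (rule P.AE_contrast_nonzero)
      show "P.indep_vars (\<lambda>_. borel) Z ?I"
        using assms(12) by (rule P.indep_vars_subset) auto
      show "2 ^ l \<le> r" using two_power_le_int_log2[OF r, of l] by (simp add: l_def)
    qed (use Z_pos w P.frechet_rv_atomless[OF frechet] in auto)
    show "h v = h v'" if "\<And>k. k \<in> ?I \<Longrightarrow> v k = v' k" for v v'
      using that by (rule h_local)
  qed (simp_all add: Z V h M.prob_space_axioms P.prob_space_axioms subset_iff)
  moreover have "distr M borel (\<lambda>\<omega>. inverse (h (\<lambda>k\<in>?I. V t k \<omega>))) =
    distr M borel (\<lambda>\<omega>. alpha_hat w l (\<lambda>i. X (int i) \<omega>) (N t) (base_scale r (N t)))" for t
  proof (rule distr_cong_AE)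
    \<comment> \<open>Rescaling inside the logarithm requires positive values. Countability of the
      index set gives a single null set for all of them, off which the estimator equals the function
      of the block maxima.\<close>
    have "AE \<omega> in M. \<forall>k. X k \<omega> > 0"
      by (subst AE_all_countable) (use assms(6) in blast)
    then show "AE \<omega> in M. inverse (h (\<lambda>k\<in>?I. V t k \<omega>)) =
      alpha_hat w l (\<lambda>i. X (int i) \<omega>) (N t) (base_scale r (N t))"
    proof eventually_elim
      case (elim \<omega>)
      have "alpha_hat w l (\<lambda>i. X (int i) \<omega>) (N t) (base_scale r (N t)) =
          alpha_hat w l (\<lambda>k. V t k \<omega>) r 0"
        unfolding l_def V_def m_def
        by (rule alpha_hat_block_max) (use elim r w assms(18) in \<open>auto simp: l_def\<close>)
      then show ?case
        using h_local[of "\<lambda>k\<in>?I. V t k \<omega>" "\<lambda>k. V t k \<omega>"] by (simp add: alpha_hat_h)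
    qed
    have "(\<lambda>\<omega>. \<lambda>k\<in>?I. V t k \<omega>) \<in> borel_measurable M"
      by (rule measurable_coordinatewise_then_product, rename_tac k, case_tac "k \<in> ?I") auto
    then show "(\<lambda>\<omega>. inverse (h (\<lambda>k\<in>?I. V t k \<omega>))) \<in> borel_measurable M" by measurable
    show "(\<lambda>\<omega>. alpha_hat w l (\<lambda>i. X (int i) \<omega>) (N t) (base_scale r (N t))) \<in> borel_measurable M"
      by measurable
  qed auto
  moreover have "inverse (h (\<lambda>k\<in>?I. Z k \<omega>)) = alpha_hat w l (\<lambda>i. Z i \<omega>) r 0" for \<omega>
    using h_local[of "\<lambda>k\<in>?I. Z k \<omega>" "\<lambda>k. Z k \<omega>"] by (simp add: alpha_hat_h)
  ultimately show ?thesis by simp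
qed

end
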